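(* $P \equiv Q \implies P \approx Q$, i.e., weakly logically equivalent states are weakly bisimilar.
   Context: Setting: a nominal transition system. It consists of a nominal set of states $P,Q,\ldots$; a nominal set of state predicates $\varphi$; an equivariant relation $P \vdash \varphi$; a nominal set of actions $\alpha$ with an equivariant function $\operatorname{bn}$ giving each action a finite set of binding names $\operatorname{bn}(\alpha)\subseteq\operatorname{supp}(\alpha)$; and an equivariant transition relation $P \xrightarrow{\alpha} P'$, where the names in $\operatorname{bn}(\alpha)$ bind into $P'$ (transitions are closed under alpha-conversion of binding names). There is a special silent action $\tau$ with empty support. We write $a \# X$ for "$a$ is not in the support of $X$". Weak transitions: $P \Rightarrow P'$ is defined inductively to mean $P=P'$ or $P \xrightarrow{\tau} P'' \Rightarrow P'$ for some $P''$; $P \stackrel{\alpha}{\Longrightarrow} P'$ means $P \Rightarrow\circ\xrightarrow{\alpha}\circ\Rightarrow P'$; and $P \stackrel{\hat\alpha}{\Longrightarrow} P'$ means $P \Rightarrow P'$ if $\alpha=\tau$ and $P \stackrel{\alpha}{\Longrightarrow} P'$ otherwise. A binary relation $R$ on states is a weak simulation if $R(P,Q)$ implies that for all $\alpha,P'$ with $\operatorname{bn}(\alpha)\# Q$, if $P\xrightarrow{\alpha}P'$ then there is $Q'$ with $Q \stackrel{\hat\alpha}{\Longrightarrow} Q'$ and $R(P',Q')$. It is a weak static implication if $R(P,Q)$ implies that for all $\varphi$, if $P\vdash\varphi$ then there is $Q'$ with $Q\Rightarrow Q'$, $Q'\vdash\varphi$ and $R(P,Q')$. A weak bisimulation is a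 symmetric relation satisfying both; $P \approx Q$ (weak bisimilarity) means some weak bisimulation relates $P$ and $Q$. Formulas: fix an infinite cardinal $\kappa$ with $\kappa>\aleph_0$ and $\kappa>|\text{states}|$. Formulas are $A ::= \bigwedge_{i\in I}A_i \mid \neg A \mid \varphi \mid \langle\alpha\rangle A$, where the conjunct set $\{A_i\mid i\in I\}$ must have cardinality $<\kappa$ and finite support, and in $\langle\alpha\rangle A$ the names $\operatorname{bn}(\alpha)$ are bound in $\alpha$ and $A$. Satisfaction: $P\models\bigwedge_{i\in I}A_i$ iff $P\models A_i$ for all $i$; $P\models\neg A$ iff not $P\models A$; $P\models\varphi$ iff $P\vdash\varphi$; $P\models\langle\alpha\rangle A$ iff (for an alpha-variant with $\operatorname{bn}(\alpha)\# P$) there is $P'$ with $P\xrightarrow{\alpha}P'$ and $P'\models A$. Disjunction $\bigvee_{i\in I}A_i$ abbreviates $\neg\bigwedge_{i\in I}\neg A_i$. Weak modalities: $\langle\langle\tau\rangle\rangle A=\bigvee_{i\in\omega}\langle\tau\rangle^iA$ (where $\langle\tau\rangle^0A=A$ and $\langle\tau\rangle^{i}A=\langle\tau\rangle\langle\tau\rangle^{i-1}A$), and $\langle\langle\alpha\rangle\rangle A=\langle\langle\tau\rangle\rangle\langle\alpha\rangle\langle\langle\tau\rangle\rangle A$ for $\alpha\ne\tau$. Weak formulas are the sublogic $A ::= \bigwedge_{i\in I}A_i \mid \neg A \mid \langle\langle\alpha\rangle\rangle A \mid \langle\langle\tau\rangle\rangle(A\wedge\varphi)$. Two states are weakly logically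 equivalent, $P\equiv Q$, if for all weak formulas $A$: $P\models A$ iff $Q\models A$. *)

theory Defs
  imports "HOL-Combinatorics.Perm" "HOL-Library.Countable_Set"
begin

unbundle cardinal_syntax

section \<open>Nominal sets\<close>

text \<open>A fixed countably infinite set of names; permutations of names are finite, i.e. move only
  finitely many names.\<close>

datatype name = Name nat

class permutable =
  fixes permute :: "name perm \<Rightarrow> 'a \<Rightarrow> 'a" (infixr \<open>\<bullet>\<close> 75)
  assumes permute_one: "1 \<bullet> x = x"
    and permute_times: "(p * q) \<bullet> x = p \<bullet> (q \<bullet> x)"

definition fixes_names :: "name perm \<Rightarrow> name set \<Rightarrow> bool" where
  "fixes_names p S \<longleftrightarrow> (\<forall>a\<in>S. apply p a = a)"

definition supports :: "name set \<Rightarrow> 'a::permutable \<Rightarrow> bool" (infix \<open>supports\<close> 50) where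
  "S supports x \<longleftrightarrow> (\<forall>p. fixes_names p S \<longrightarrow> p \<bullet> x = x)"

definition finitely_supported :: "'a::permutable \<Rightarrow> bool" where
  "finitely_supported x \<longleftrightarrow> (\<exists>S. finite S \<and> S supports x)"

text \<open>For finitely supported elements this is the least finite supporting set.\<close>

definition supp :: "'a::permutable \<Rightarrow> name set" where
  "supp x = \<Inter>{S. finite S \<and> S supports x}"

definition fresh_set :: "name set \<Rightarrow> 'a::permutable \<Rightarrow> bool" (infix \<open>\<sharp>\<close> 50) where
  "S \<sharp> x \<longleftrightarrow> (\<forall>a\<in>S. a \<notin> supp x)"

class nominal = permutable +
  assumes nominal: "finitely_supported x"

instantiation name :: permutable
begin
definition permute_name :: "name perm \<Rightarrow> name \<Rightarrow> name" where
  "p \<bullet> a = apply p a"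
instance
  by standard (simp_all add: permute_name_def apply_times)
end

instantiation set :: (permutable) permutable
begin
definition permute_set :: "name perm \<Rightarrow> 'a set \<Rightarrow> 'a set" where
  "p \<bullet> X = permute p ` X"
instance
  by standard (simp_all add: permute_set_def permute_one permute_times image_image)
end

instantiation prod :: (permutable, permutable) permutable
begin
definition permute_prod :: "name perm \<Rightarrow> 'a \<times> 'b \<Rightarrow> 'a \<times> 'b" where
  "p \<bullet> z = (p \<bullet> fst z, p \<bullet> snd z)"
instance
  by standard (simp_all add: permute_prod_def permute_one permute_times)
end

lemma permute_inverse: "inverse p \<bullet> p \<bullet> x = x" "p \<bullet> inverse p \<bullet> x = (x::'a::permutable)"
  by (simp_all flip: permute_times add: permute_one perm.left_inverse perm.right_inverse)

lemma permute_inject: "p \<bullet> x = p \<bullet> y \<longleftrightarrow> x = (y::'a::permutable)"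
  by (metis permute_inverse(1))

lemma infinite_name: "infinite (UNIV::name set)"
proof -
  have "range Name = UNIV" by (auto simp: image_iff) (metis name.exhaust)
  moreover have "inj Name" by (auto simp: inj_def)
  ultimately show ?thesis by (metis finite_imageD infinite_UNIV_nat)
qed

lemma supports_minus:
  fixes x :: "'a::permutable"
  assumes S: "finite S" "S supports x" and T: "finite T" "T supports x" and a: "a \<in> T" "a \<notin> S"
  shows "(T - {a}) supports x"
  unfolding supports_def
proof (intro allI impI)
  fix p assume p: "fixes_names p (T - {a})"
  have "finite (S \<union> T \<union> affected p \<union> {a})" using S T by simp
  then obtain b where b: "b \<notin> S \<union> T \<union> affected p \<union> {a}" using infinite_name
    by (metis ex_new_if_finite)
  define q where "q = Perm.swap a b"
  have q: "apply q a = b" "apply q b = a" "\<And>c. c \<noteq> a \<Longrightarrow> c \<noteq> b \<Longrightarrow> apply q c = c"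
    unfolding q_def by simp_all
  have pb: "apply p b = b" using b by (auto simp: in_affected)
  have qx: "q \<bullet> x = x" using S(2) q b a unfolding supports_def fixes_names_def by (metis UnCI)
  have "fixes_names (q * p * q) T" using p q pb b unfolding fixes_names_def
    by (auto simp: apply_times) (metis DiffI UnCI singletonD)
  then have "q \<bullet> p \<bullet> q \<bullet> x = x" using T(2) unfolding supports_def by (metis permute_times)
  then show "p \<bullet> x = x" using qx by (metis permute_inject)
qed

lemma supports_Int:
  fixes x :: "'a::permutable"
  assumes S: "finite S" "S supports x" and T: "finite T" "T supports x"
  shows "(S \<inter> T) supports x"
proof -
  have "finite D \<Longrightarrow> D \<subseteq> T - S \<Longrightarrow> (T - D) supports x" for D
  proof (induction D rule: finite_induct)
    case (insert a D)
    have "(T - D - {a}) supports x"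
      by (rule supports_minus[OF S]) (use insert T in auto)
    then show ?case by (subst Diff_insert)
  qed (use T in simp)
  from this[of "T - S"] T show ?thesis by (simp add: Diff_Diff_Int Int_commute)
qed

lemma supp_supports: 
  fixes x :: "'a::permutable"
  assumes "finitely_supported x" shows "finite (supp x)" "supp x supports x"
proof -
  obtain S where S: "finite S" "S supports x" "\<And>T. finite T \<Longrightarrow> T supports x \<Longrightarrow> card S \<le> card T"
    using assms ex_has_least_nat[of "\<lambda>S. finite S \<and> S supports x" _ card]
    unfolding finitely_supported_def by metis
  have "S \<subseteq> T" if "finite T" "T supports x" for T
  proof -
    have "card S \<le> card (S \<inter> T)" using S supports_Int[OF S(1,2) that] by simp
    then show ?thesis by (metis S(1) card_seteq inf.cobounded1 inf.absorb_iff1)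
  qed
  then have "supp x = S" using S unfolding supp_def by blast
  with S show "finite (supp x)" "supp x supports x" by auto
qed

lemma fixes_names_conj: "fixes_names (inverse q * p * q) S \<longleftrightarrow> fixes_names p (q \<bullet> S)"
  unfolding fixes_names_def permute_set_def permute_name_def
  apply (auto simp: apply_times)
   apply (metis apply_sequence perm.right_inverse apply_one id_apply apply_times comp_apply)
  apply (metis apply_sequence perm.left_inverse apply_one id_apply apply_times comp_apply)
  done

lemma supports_permute: "S supports x \<Longrightarrow> (q \<bullet> S) supports (q \<bullet> x)"
  unfolding supports_def
proof (intro allI impI)
  fix p assume S: "\<forall>p. fixes_names p S \<longrightarrow> p \<bullet> x = x" and p: "fixes_names p (q \<bullet> S)"
  then have "(inverse q * p * q) \<bullet> x = x" by (simp add: fixes_names_conj)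
  then show "p \<bullet> q \<bullet> x = q \<bullet> x" by (metis permute_times permute_inverse(2))
qed

lemma finite_permute_iff: "finite (q \<bullet> S) \<longleftrightarrow> finite (S::name set)"
  unfolding permute_set_def by (rule finite_image_iff) (auto simp: inj_on_def permute_inject)

lemma supp_eqvt: 
  shows "supp (q \<bullet> x) = q \<bullet> supp (x::'a::permutable)"
proof -
  have 1: "q \<bullet> supp x \<subseteq> supp (q \<bullet> x)" for q and x :: 'a
  proof
    fix a assume "a \<in> q \<bullet> supp x"
    then obtain b where b: "b \<in> supp x" "a = q \<bullet> b" by (auto simp: permute_set_def)
    show "a \<in> supp (q \<bullet> x)" unfolding supp_def
    proof clarsimp
      fix S assume S: "finite S" "S supports (q \<bullet> x)"
      then have "(inverse q \<bullet> S) supports x" using supports_permute[OF S(2), of "inverse q"] by (simp add: permute_inverse)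
      then have "b \<in> inverse q \<bullet> S" using b(1) S(1) by (auto simp: supp_def finite_permute_iff)
      then show "a \<in> S" unfolding b(2) by (auto simp: permute_set_def permute_inverse)
    qed
  qed
  have "inverse q \<bullet> supp (q \<bullet> x) \<subseteq> supp x" using 1[of "inverse q" "q \<bullet> x"] by (simp add: permute_inverse)
  then have "q \<bullet> inverse q \<bullet> supp (q \<bullet> x) \<subseteq> q \<bullet> supp x" unfolding permute_set_def by blast
  with 1[of q x] show ?thesis by (simp add: permute_inverse)
qed

lemma countable_perm: "countable (UNIV :: name perm set)"
proof -
  let ?f = "\<lambda>p::name perm. (\<lambda>a. (a, apply p a)) ` affected p"
  have "inj ?f"
  proof
    fix p q :: "name perm" assume eq: "?f p = ?f q"
    show "p = q"
    proof (rule perm_eqI)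
      fix a
      have f: "(a, b) \<in> ?f p \<longleftrightarrow> a \<in> affected p \<and> b = apply p a" for b and p :: "name perm" by auto
      show "apply p a = apply q a" using f[of _ p] f[of _ q] unfolding eq in_affected by metis
    qed
  qed
  moreover have "range ?f \<subseteq> {X. finite X}" by auto
  moreover have "countable (UNIV :: name set)"
    by (rule countableI'[of "case_name id"]) (auto simp: inj_on_def split: name.splits)
  moreover have "countable (UNIV :: (name\<times>name) set)"
    using calculation(3) by (metis UNIV_Times_UNIV countable_SIGMA)
  then have "countable {X::(name\<times>name) set. finite X}" using countable_Collect_finite_subset[of "UNIV::(name\<times>name) set"] by simp
  ultimately have "countable (range ?f)" "inj ?f" by (auto intro: countable_subset)
  then show ?thesis by (rule countable_image_inj_on)
qed

text \<open>The alpha-equivalence class of the pair \<open>(\<alpha>, x)\<close> in which the names \<open>bn \<alpha>\<close> are bound in both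
  components, for an equivariant function \<open>bn\<close>.\<close>

definition alpha_class ::
  "('act::permutable \<Rightarrow> name set) \<Rightarrow> 'act \<Rightarrow> 'a::permutable \<Rightarrow> ('act \<times> 'a) set" where
  "alpha_class bn \<alpha> x = {p \<bullet> (\<alpha>, x) | p. fixes_names p (supp (\<alpha>, x) - bn \<alpha>)}"

lemma ex_range_alpha_class: "\<exists>f::nat \<Rightarrow> _. range f = alpha_class bn \<alpha> A"
proof -
  have "countable (alpha_class bn \<alpha> A)"
    unfolding alpha_class_def setcompr_eq_image using countable_perm by (metis countable_image countable_subset subset_UNIV)
  moreover have "alpha_class bn \<alpha> A \<noteq> {}" unfolding alpha_class_def
    by (auto simp: fixes_names_def permute_prod_def intro!: exI[of _ 1])
  ultimately show ?thesis by (metis range_from_nat_into)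
qed

lemma alpha_class_eqvt:
  assumes "\<And>p \<alpha>. bn (p \<bullet> \<alpha>) = p \<bullet> bn \<alpha>"
  shows "alpha_class bn (q \<bullet> \<alpha>) (q \<bullet> x) = q \<bullet> alpha_class bn \<alpha> x"
proof -
  have d: "supp (q \<bullet> (\<alpha>,x)) - bn (q \<bullet> \<alpha>) = q \<bullet> (supp (\<alpha>,x) - bn \<alpha>)"
    unfolding supp_eqvt assms unfolding permute_set_def by (auto simp: permute_inject)
  have e: "(q \<bullet> \<alpha>, q \<bullet> x) = q \<bullet> (\<alpha>, x)" by (simp add: permute_prod_def)
  show ?thesis unfolding alpha_class_def e d unfolding fixes_names_conj[symmetric]
  proof (rule set_eqI, rule iffI)
    fix z assume "z \<in> {p \<bullet> q \<bullet> (\<alpha>, x) |p. fixes_names (inverse q * p * q) (supp (\<alpha>, x) - bn \<alpha>)}"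
    then obtain p where "z = p \<bullet> q \<bullet> (\<alpha>, x)" "fixes_names (inverse q * p * q) (supp (\<alpha>, x) - bn \<alpha>)" by blast
    then show "z \<in> q \<bullet> {p \<bullet> (\<alpha>, x) |p. fixes_names p (supp (\<alpha>, x) - bn \<alpha>)}"
      unfolding permute_set_def image_iff by (metis (mono_tags, lifting) mem_Collect_eq permute_times permute_inverse(2))
  next
    fix z assume "z \<in> q \<bullet> {p \<bullet> (\<alpha>, x) |p. fixes_names p (supp (\<alpha>, x) - bn \<alpha>)}"
    then obtain p where p: "z = q \<bullet> p \<bullet> (\<alpha>, x)" "fixes_names p (supp (\<alpha>, x) - bn \<alpha>)" unfolding permute_set_def by blast
    have "inverse q * (q * p * inverse q) * q = p"
      by (metis mult.assoc perm.left_inverse mult_1_left mult_1_right)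
    moreover have "z = (q * p * inverse q) \<bullet> q \<bullet> (\<alpha>,x)" by (simp add: p permute_times permute_inverse)
    ultimately show "z \<in> {p \<bullet> q \<bullet> (\<alpha>, x) |p. fixes_names (inverse q * p * q) (supp (\<alpha>, x) - bn \<alpha>)}"
      using p(2) by (metis (mono_tags, lifting) mem_Collect_eq)
  qed
qed


section \<open>Formulas\<close>

text \<open>Formulas up to alpha-equivalence, with conjunctions of sets of formulas. The set of conjuncts is
  enumerated by a partial function on \<open>nat + 'k\<close>, where the type \<open>'k\<close> carries the cardinal \<open>\<kappa>\<close>.
  A formula \<open>\<langle>\<alpha>\<rangle>A\<close> is represented by its alpha-equivalence class of pairs, which is countable
  and enumerated by a function on \<open>nat\<close>. The quotient by \<open>raw_eq\<close> makes the order and the repetitions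
  of these enumerations irrelevant, so that equality on the quotient is alpha-equivalence.\<close>

datatype ('k, 'pred, 'act) raw =
    RConj "nat + 'k \<Rightarrow> ('k, 'pred, 'act) raw option"
  | RNot "('k, 'pred, 'act) raw"
  | RPred 'pred
  | RAlts "nat \<Rightarrow> 'act \<times> ('k, 'pred, 'act) raw"

inductive raw_eq :: "('k, 'pred, 'act) raw \<Rightarrow> ('k, 'pred, 'act) raw \<Rightarrow> bool" where
  "\<lbrakk>\<forall>s\<in>ran f. \<exists>t\<in>ran g. raw_eq s t; \<forall>t\<in>ran g. \<exists>s\<in>ran f. raw_eq s t\<rbrakk>
    \<Longrightarrow> raw_eq (RConj f) (RConj g)"
| "raw_eq s t \<Longrightarrow> raw_eq (RNot s) (RNot t)"
| "raw_eq (RPred \<phi>) (RPred \<phi>)"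
| "\<lbrakk>\<forall>m. \<exists>n. fst (f m) = fst (g n) \<and> raw_eq (snd (f m)) (snd (g n));
    \<forall>n. \<exists>m. fst (f m) = fst (g n) \<and> raw_eq (snd (f m)) (snd (g n))\<rbrakk>
    \<Longrightarrow> raw_eq (RAlts f) (RAlts g)"

lemma raw_eq_refl: "raw_eq t t"
proof (induction t)
  case (RConj f)
  have "raw_eq s s" if "s \<in> ran f" for s
    using that RConj by (auto simp: ran_def) (metis option.set_intros rangeI)
  then show ?case by (blast intro: raw_eq.intros)
next
  case (RAlts f)
  have "raw_eq (snd (f n)) (snd (f n))" for n
    using RAlts[of "f n" "snd (f n)"] by (simp add: snds.simps)
  then show ?case by (blast intro: raw_eq.intros)
qed (auto intro: raw_eq.intros)

lemma raw_eq_sym: "raw_eq s t \<Longrightarrow> raw_eq t s"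
proof (induction rule: raw_eq.induct)
  case (1 f g)
  then show ?case by (intro raw_eq.intros) blast+
next
  case (4 f g)
  then show ?case by (intro raw_eq.intros) metis+
qed (auto intro: raw_eq.intros)

lemma raw_eq_trans: "raw_eq s t \<Longrightarrow> raw_eq t u \<Longrightarrow> raw_eq s u"
proof (induction arbitrary: u rule: raw_eq.induct)
  case (1 f g)
  from 1(3) obtain h where u: "u = RConj h"
    "\<forall>s\<in>ran g. \<exists>t\<in>ran h. raw_eq s t" "\<forall>t\<in>ran h. \<exists>s\<in>ran g. raw_eq s t"
    by (auto elim: raw_eq.cases)
  show ?case unfolding u(1) using 1(1,2) u(2,3) by (intro raw_eq.intros) meson+
next
  case (2 s t)
  from 2(3) show ?case by cases (auto intro: raw_eq.intros 2)
next
  case (4 f g)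
  from 4(3) obtain h where u: "u = RAlts h"
    "\<forall>m. \<exists>n. fst (g m) = fst (h n) \<and> raw_eq (snd (g m)) (snd (h n))"
    "\<forall>n. \<exists>m. fst (g m) = fst (h n) \<and> raw_eq (snd (g m)) (snd (h n))"
    by (auto elim: raw_eq.cases)
  show ?case unfolding u(1) using 4(1,2) u(2,3) by (intro raw_eq.intros) metis+
qed auto

quotient_type ('k, 'pred, 'act) formula = "('k, 'pred, 'act) raw" / raw_eq
  by (rule equivpI) (auto simp: reflp_def symp_def transp_def
      intro: raw_eq_refl raw_eq_sym raw_eq_trans)

lemma raw_eq_RConj: "rel_fun (=) (rel_option raw_eq) f g \<Longrightarrow> raw_eq (RConj f) (RConj g)"
proof (rule raw_eq.intros)
  assume "rel_fun (=) (rel_option raw_eq) f g"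
  then have *: "rel_option raw_eq (f i) (g i)" for i
    by (simp add: rel_fun_def)
  show "\<forall>s\<in>ran f. \<exists>t\<in>ran g. raw_eq s t"
    unfolding ran_def by clarsimp (metis * option_rel_Some1)
  show "\<forall>t\<in>ran g. \<exists>s\<in>ran f. raw_eq s t"
    unfolding ran_def by clarsimp (metis * option_rel_Some2)
qed

lift_definition Conj_family ::
  "(nat + 'k \<Rightarrow> ('k, 'pred, 'act) formula option) \<Rightarrow> ('k, 'pred, 'act) formula" is RConj
  by (rule raw_eq_RConj) (simp add: rel_fun_def)

lift_definition Neg :: "('k, 'pred, 'act) formula \<Rightarrow> ('k, 'pred, 'act) formula" is RNot
  by (rule raw_eq.intros)

lift_definition Pred :: "'pred \<Rightarrow> ('k, 'pred, 'act) formula" is RPred .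

lift_definition Alts ::
  "(nat \<Rightarrow> 'act \<times> ('k, 'pred, 'act) formula) \<Rightarrow> ('k, 'pred, 'act) formula" is RAlts
  by (rule raw_eq.intros) (auto simp: rel_fun_def rel_prod_sel)

primrec permute_raw ::
  "name perm \<Rightarrow> ('k, 'pred::permutable, 'act::permutable) raw \<Rightarrow> ('k, 'pred, 'act) raw" where
  "permute_raw p (RConj f) = RConj (\<lambda>i. map_option (permute_raw p) (f i))"
| "permute_raw p (RNot t) = RNot (permute_raw p t)"
| "permute_raw p (RPred \<phi>) = RPred (p \<bullet> \<phi>)"
| "permute_raw p (RAlts f) = RAlts (\<lambda>n. map_prod (permute p) (permute_raw p) (f n))"

lemma ran_map_option: "ran (\<lambda>i. map_option h (f i)) = h ` ran f"
  by (auto simp: ran_def)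

lemma raw_eq_permute_raw: "raw_eq s t \<Longrightarrow> raw_eq (permute_raw p s) (permute_raw p t)"
proof (induction rule: raw_eq.induct)
  case (1 f g)
  then show ?case
    unfolding permute_raw.simps by (intro raw_eq.intros) (force simp: ran_map_option)+
next
  case (4 f g)
  then show ?case
    unfolding permute_raw.simps by (intro raw_eq.intros) (simp_all, metis+)
qed (auto intro: raw_eq.intros)

lemma permute_raw_one: "permute_raw 1 t = t"
proof (induction t)
  case (RConj f)
  have "map_option (permute_raw 1) (f i) = f i" for i
    by (rule option.map_ident_strong) (use RConj in \<open>blast intro: rangeI\<close>)
  then show ?case by simp
next
  case (RAlts f)
  have "map_prod (permute 1) (permute_raw 1) (f n) = f n" for n
    using RAlts[of "f n" "snd (f n)"]
    by (simp add: prod_eq_iff permute_one snds.simps)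
  then show ?case by simp
qed (auto simp: permute_one)

lemma permute_raw_times: "permute_raw (p * q) t = permute_raw p (permute_raw q t)"
proof (induction t)
  case (RConj f)
  have "map_option (permute_raw (p * q)) (f i) = map_option (permute_raw p \<circ> permute_raw q) (f i)"
    for i
    by (rule option.map_cong0) (use RConj in \<open>simp, blast intro: rangeI\<close>)
  then show ?case by (simp add: option.map_comp)
next
  case (RAlts f)
  have "map_prod (permute (p * q)) (permute_raw (p * q)) (f n) =
    map_prod (permute p) (permute_raw p) (map_prod (permute q) (permute_raw q) (f n))" for n
    using RAlts[of "f n" "snd (f n)"]
    by (simp add: prod_eq_iff permute_times snds.simps)
  then show ?case by simp
qed (auto simp: permute_times)

instantiation formula :: (type, permutable, permutable) permutable
begin
lift_definition permute_formula ::
  "name perm \<Rightarrow> ('a, 'b, 'c) formula \<Rightarrow> ('a, 'b, 'c) formula" is permute_raw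
  by (rule raw_eq_permute_raw)
instance
proof
  fix x :: "('a, 'b, 'c) formula" and p q :: "name perm"
  show "1 \<bullet> x = x"
    by transfer (simp add: permute_raw_one raw_eq_refl)
  show "(p * q) \<bullet> x = p \<bullet> (q \<bullet> x)"
    by transfer (simp add: permute_raw_times raw_eq_refl)
qed
end

lemma permute_Conj_family: 
  fixes X :: "('k,'p::permutable,'a::permutable) formula set"
  shows "p \<bullet> Conj_family f = (Conj_family (\<lambda>i. map_option (permute p) (f i)) :: ('k,'p,'a) formula)"
  by transfer (simp add: raw_eq_refl)

lemma permute_Alts: "p \<bullet> Alts f = Alts (\<lambda>i. p \<bullet> f i)"
  unfolding permute_prod_def
  apply transfer
  apply (simp add: raw_eq_refl map_prod_def case_prod_beta)
  done

lemma permute_Neg: "p \<bullet> Neg A = Neg (p \<bullet> A)"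
  by transfer (simp add: raw_eq_refl)

lemma permute_Pred: "p \<bullet> Pred A = Pred (p \<bullet> A)"
  by transfer (simp add: raw_eq_refl)

lemma Conj_family_cong: "ran f = ran g \<Longrightarrow> Conj_family f = Conj_family g"
proof -
  assume a: "ran f = ran g"
  have Q: "Conj_family f = abs_formula (RConj (\<lambda>i. map_option rep_formula (f i)))" for f
    by (simp add: Conj_family_def comp_def map_fun_def)
  show ?thesis unfolding Q formula.abs_eq_iff
    by (rule raw_eq.intros) (auto simp: ran_map_option a intro: raw_eq_refl)
qed

lemma Alts_cong: "range f = range g \<Longrightarrow> Alts f = Alts g"
proof -
  assume a: "range f = range g"
  have Q: "Alts f = abs_formula (RAlts (\<lambda>i. map_prod id rep_formula (f i)))" for f
    by (simp add: Alts_def comp_def map_fun_def)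
  show ?thesis unfolding Q formula.abs_eq_iff
    apply (rule raw_eq.intros)
    apply simp_all using a apply (metis rangeI raw_eq_refl imageE)
    using a by (metis rangeI raw_eq_refl imageE)
qed

text \<open>The conjunction of \<open>X\<close>, meaningful for sets \<open>X\<close> that \<open>nat + 'k\<close> can enumerate; in particular for all sets of
  cardinality below a cardinal on \<open>'k\<close>, and for all countable sets.\<close>

definition Conj :: "('k, 'pred, 'act) formula set \<Rightarrow> ('k, 'pred, 'act) formula" where
  "Conj X = Conj_family (SOME f. ran f = X)"

definition Disj :: "('k, 'pred, 'act) formula set \<Rightarrow> ('k, 'pred, 'act) formula" where
  "Disj X = Neg (Conj (Neg ` X))"

lemma ex_ran:
  fixes X :: "'a set"
  assumes "|X| \<le>o |UNIV :: (nat + 'k) set|"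
  shows "\<exists>f :: nat + 'k \<Rightarrow> 'a option. ran f = X"
proof -
  obtain h :: "'a \<Rightarrow> nat + 'k" where h: "inj_on h X" using assms by (auto simp flip: card_of_ordLeq)
  define f where "f = (\<lambda>i. if i \<in> h ` X then Some (inv_into X h i) else None)"
  have "f (h x) = Some x" if "x \<in> X" for x using that h by (simp add: f_def)
  moreover have "x \<in> X" if "f i = Some x" for x i using that by (auto simp: f_def inv_into_into split: if_splits)
  ultimately have "ran f = X" unfolding ran_def by blast
  then show ?thesis by blast
qed

lemma Conj_eq_family:
  fixes X :: "('k,'p,'a) formula set"
  assumes "|X| \<le>o |UNIV :: (nat + 'k) set|"
  shows "ran f = X \<Longrightarrow> Conj X = Conj_family f" "ran (SOME f :: nat+'k \<Rightarrow> _. ran f = X) = X"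
proof -
  show "ran (SOME f :: nat+'k \<Rightarrow> _. ran f = X) = X" using ex_ran[OF assms] by (rule someI_ex)
  then show "ran f = X \<Longrightarrow> Conj X = Conj_family f" 
    unfolding Conj_def by (metis Conj_family_cong)
qed


section \<open>Nominal transition systems\<close>

locale nominal_transition_system =
  fixes entails :: "'state::nominal \<Rightarrow> 'pred::nominal \<Rightarrow> bool" (infix \<open>\<turnstile>\<close> 50)
    and bn :: "'act::nominal \<Rightarrow> name set"
    and trans :: "'state \<Rightarrow> 'act \<Rightarrow> 'state \<Rightarrow> bool"
    and tau :: 'act
  assumes entails_eqvt: "P \<turnstile> \<phi> \<Longrightarrow> p \<bullet> P \<turnstile> p \<bullet> \<phi>"
    and bn_eqvt: "bn (p \<bullet> \<alpha>) = p \<bullet> bn \<alpha>"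
    and bn_finite: "finite (bn \<alpha>)"
    and bn_supp: "bn \<alpha> \<subseteq> supp \<alpha>"
    and trans_eqvt: "trans P \<alpha> P' \<Longrightarrow> trans (p \<bullet> P) (p \<bullet> \<alpha>) (p \<bullet> P')"
    and trans_alpha: "trans P \<alpha> P' \<Longrightarrow> (\<beta>, P'') \<in> alpha_class bn \<alpha> P' \<Longrightarrow> trans P \<beta> P''"
    and tau_supp: "supp tau = {}"
begin

subsection \<open>Weak bisimilarity\<close>

inductive weak_tau :: "'state \<Rightarrow> 'state \<Rightarrow> bool" where
  "weak_tau P P"
| "trans P tau P'' \<Longrightarrow> weak_tau P'' P' \<Longrightarrow> weak_tau P P'"

definition weak_trans :: "'state \<Rightarrow> 'act \<Rightarrow> 'state \<Rightarrow> bool" where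
  "weak_trans P \<alpha> P' \<longleftrightarrow> (\<exists>Q Q'. weak_tau P Q \<and> trans Q \<alpha> Q' \<and> weak_tau Q' P')"

definition weak_hat_trans :: "'state \<Rightarrow> 'act \<Rightarrow> 'state \<Rightarrow> bool" where
  "weak_hat_trans P \<alpha> P' \<longleftrightarrow> (if \<alpha> = tau then weak_tau P P' else weak_trans P \<alpha> P')"

definition weak_simulation :: "('state \<Rightarrow> 'state \<Rightarrow> bool) \<Rightarrow> bool" where
  "weak_simulation R \<longleftrightarrow> (\<forall>P Q. R P Q \<longrightarrow>
     (\<forall>\<alpha> P'. bn \<alpha> \<sharp> Q \<longrightarrow> trans P \<alpha> P' \<longrightarrow> (\<exists>Q'. weak_hat_trans Q \<alpha> Q' \<and> R P' Q')))"

definition weak_static_implication :: "('state \<Rightarrow> 'state \<Rightarrow> bool) \<Rightarrow> bool" where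
  "weak_static_implication R \<longleftrightarrow> (\<forall>P Q. R P Q \<longrightarrow>
     (\<forall>\<phi>. P \<turnstile> \<phi> \<longrightarrow> (\<exists>Q'. weak_tau Q Q' \<and> Q' \<turnstile> \<phi> \<and> R P Q')))"

definition weak_bisimulation :: "('state \<Rightarrow> 'state \<Rightarrow> bool) \<Rightarrow> bool" where
  "weak_bisimulation R \<longleftrightarrow> symp R \<and> weak_simulation R \<and> weak_static_implication R"

definition weakly_bisimilar :: "'state \<Rightarrow> 'state \<Rightarrow> bool" where
  "weakly_bisimilar P Q \<longleftrightarrow> (\<exists>R. weak_bisimulation R \<and> R P Q)"


subsection \<open>Satisfaction\<close>

definition Dia :: "'act \<Rightarrow> ('k, 'pred, 'act) formula \<Rightarrow> ('k, 'pred, 'act) formula" where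
  "Dia \<alpha> A = Alts (SOME f. range f = alpha_class bn \<alpha> A)"

primrec raw_sat :: "('k, 'pred, 'act) raw \<Rightarrow> 'state \<Rightarrow> bool" where
  "raw_sat (RConj f) = (\<lambda>P. \<forall>s\<in>ran (\<lambda>i. map_option raw_sat (f i)). s P)"
| "raw_sat (RNot t) = (\<lambda>P. \<not> raw_sat t P)"
| "raw_sat (RPred \<phi>) = (\<lambda>P. P \<turnstile> \<phi>)"
| "raw_sat (RAlts f) = (\<lambda>P. \<exists>(\<beta>, s) \<in> range (\<lambda>n. map_prod id raw_sat (f n)).
     bn \<beta> \<sharp> P \<and> (\<exists>P'. trans P \<beta> P' \<and> s P'))"

lemma raw_sat_raw_eq: "raw_eq s t \<Longrightarrow> raw_sat s = raw_sat t"
proof (induction rule: raw_eq.induct)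
  case (1 f g)
  then have "raw_sat ` ran f = raw_sat ` ran g"
    by (auto simp: image_iff) metis+
  then show ?case by (simp add: ran_map_option)
next
  case (4 f g)
  then have "range (\<lambda>n. map_prod id raw_sat (f n)) = range (\<lambda>n. map_prod id raw_sat (g n))"
    by (auto simp: image_iff prod_eq_iff) metis+
  then show ?case by simp
qed auto

lift_definition sat :: "('k, 'pred, 'act) formula \<Rightarrow> 'state \<Rightarrow> bool" is raw_sat
  by (rule raw_sat_raw_eq)

abbreviation satisfies :: "'state \<Rightarrow> ('k, 'pred, 'act) formula \<Rightarrow> bool" (infix \<open>\<Turnstile>\<close> 50) where
  "P \<Turnstile> A \<equiv> sat A P"

lemma sat_Conj:
  fixes X :: "('k,'pred,'act) formula set"
  assumes "|X| \<le>o |UNIV :: (nat + 'k) set|"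
  shows "P \<Turnstile> Conj X \<longleftrightarrow> (\<forall>A\<in>X. P \<Turnstile> A)"
proof -
  have "P \<Turnstile> Conj_family f \<longleftrightarrow> (\<forall>A\<in>ran f. P \<Turnstile> A)" for f :: "nat+'k \<Rightarrow> ('k,'pred,'act) formula option"
  proof -
    have "Conj_family f = abs_formula (RConj (\<lambda>i. map_option rep_formula (f i)))"
      by (simp add: Conj_family_def comp_def map_fun_def)
    then have "P \<Turnstile> Conj_family f \<longleftrightarrow> raw_sat (RConj (\<lambda>i. map_option rep_formula (f i))) P"
      by (simp only: sat.abs_eq)
    also have "\<dots> \<longleftrightarrow> (\<forall>A\<in>ran f. P \<Turnstile> A)"
      by (simp add: ran_map_option sat.rep_eq)
    finally show ?thesis .
  qed
  then show ?thesis using Conj_eq_family(2)[OF assms] by (simp add: Conj_def)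
qed

lemma sat_Neg: "P \<Turnstile> Neg A \<longleftrightarrow> \<not> P \<Turnstile> A" by transfer simp

lemma sat_Pred: "P \<Turnstile> Pred \<phi> \<longleftrightarrow> P \<turnstile> \<phi>" by transfer simp

lemma Dia_range: "range (SOME f :: nat \<Rightarrow> _. range f = alpha_class bn \<alpha> A) = alpha_class bn \<alpha> A"
  using ex_range_alpha_class by (rule someI_ex)

lemma sat_Dia: "P \<Turnstile> Dia \<alpha> A \<longleftrightarrow>
  (\<exists>(\<beta>, B) \<in> alpha_class bn \<alpha> A. bn \<beta> \<sharp> P \<and> (\<exists>P'. trans P \<beta> P' \<and> P' \<Turnstile> B))"
proof -
  have "P \<Turnstile> Alts f \<longleftrightarrow> (\<exists>(\<beta>, B) \<in> range f. bn \<beta> \<sharp> P \<and> (\<exists>P'. trans P \<beta> P' \<and> P' \<Turnstile> B))"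
    for f :: "nat \<Rightarrow> 'act \<times> ('k,'pred,'act) formula"
    apply transfer
    by (simp add: case_prod_beta)
  from this[of "SOME f. range f = alpha_class bn \<alpha> A"] show ?thesis unfolding Dia_range Dia_def .
qed

lemma Dia_eqvt: fixes A :: "('k,'pred,'act) formula" shows "p \<bullet> Dia \<alpha> A = Dia (p \<bullet> \<alpha>) (p \<bullet> A)"
proof -
  have "range (\<lambda>i. p \<bullet> f i) = p \<bullet> range f" for f :: "nat \<Rightarrow> 'act \<times> ('k,'pred,'act) formula"
    unfolding permute_set_def image_image ..
  note 1 = this[of "SOME f. range f = alpha_class bn \<alpha> A", unfolded Dia_range]
  show ?thesis unfolding Dia_def permute_Alts
    by (rule Alts_cong) (unfold 1 Dia_range, rule alpha_class_eqvt[of bn, OF bn_eqvt, symmetric])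
qed

lemma tau_eqvt: "p \<bullet> tau = tau"
  using supp_supports(2)[OF nominal, of tau] tau_supp by (simp add: supports_def fixes_names_def)

lemma funpow_Dia_tau_eqvt: "p \<bullet> (Dia tau ^^ n) A = (Dia tau ^^ n) (p \<bullet> A)"
  by (induction n) (simp_all add: Dia_eqvt tau_eqvt)

lemma Conj_eqvt:
  fixes X :: "('k,'pred,'act) formula set"
  assumes "|X| \<le>o |UNIV :: (nat + 'k) set|"
  shows "p \<bullet> Conj X = Conj (p \<bullet> X)"
proof -
  have "|p \<bullet> X| \<le>o |UNIV :: (nat + 'k) set|"
    unfolding permute_set_def using assms card_of_image ordLeq_transitive by blast
  from Conj_eq_family(1)[OF this, of "\<lambda>i. map_option (permute p) ((SOME f :: nat+'k \<Rightarrow> _. ran f = X) i)"]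
  show ?thesis unfolding ran_map_option Conj_eq_family(2)[OF assms] 
    by (simp add: permute_set_def Conj_def permute_Conj_family)
qed

lemma Dia_inject:
  fixes A B :: "('k,'pred,'act) formula"
  assumes "Dia \<alpha> A = Dia \<beta> B" shows "alpha_class bn \<alpha> A = alpha_class bn \<beta> B"
proof -
  have Q: "Alts f = abs_formula (RAlts (\<lambda>i. map_prod id rep_formula (f i)))" for f :: "nat \<Rightarrow> 'act \<times> ('k,'pred,'act) formula"
    by (simp add: Alts_def comp_def map_fun_def)
  have r: "raw_eq (rep_formula x) (rep_formula y) \<longleftrightarrow> x = y" for x y :: "('k,'pred,'act) formula"
    by (metis Quotient3_formula Quotient3_rel_rep)
  have "range f = range g" if "Alts f = Alts g" for f g :: "nat \<Rightarrow> 'act \<times> ('k,'pred,'act) formula"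
  proof -
    have "raw_eq (RAlts (\<lambda>i. map_prod id rep_formula (f i))) (RAlts (\<lambda>i. map_prod id rep_formula (g i)))"
      using that unfolding Q formula.abs_eq_iff .
    then have 1: "\<forall>m. \<exists>n. f m = g n" and 2: "\<forall>n. \<exists>m. f m = g n"
      by (cases; simp add: r prod_eq_iff)+
    show ?thesis using 1 2 unfolding image_def by (intro set_eqI iffI; clarsimp) metis+
  qed
  from this[OF assms[unfolded Dia_def]] show ?thesis unfolding Dia_range .
qed

definition weak_Dia_tau :: "('k, 'pred, 'act) formula \<Rightarrow> ('k, 'pred, 'act) formula" where
  "weak_Dia_tau A = Disj (range (\<lambda>i::nat. (Dia tau ^^ i) A))"

definition weak_Dia :: "'act \<Rightarrow> ('k, 'pred, 'act) formula \<Rightarrow> ('k, 'pred, 'act) formula" where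
  "weak_Dia \<alpha> A =
     (if \<alpha> = tau then weak_Dia_tau A else weak_Dia_tau (Dia \<alpha> (weak_Dia_tau A)))"

end

locale nominal_transition_system_logic = nominal_transition_system entails bn trans tau
  for entails :: "'state::nominal \<Rightarrow> 'pred::nominal \<Rightarrow> bool" (infix \<open>\<turnstile>\<close> 50)
    and bn :: "'act::nominal \<Rightarrow> name set"
    and trans :: "'state \<Rightarrow> 'act \<Rightarrow> 'state \<Rightarrow> bool"
    and tau :: 'act +
  fixes \<kappa> :: "'k rel"
  assumes kappa_card: "Card_order \<kappa>"
    and kappa_nat: "natLeq <o \<kappa>"
    and kappa_state: "|UNIV :: 'state set| <o \<kappa>"
begin

inductive is_formula :: "('k, 'pred, 'act) formula \<Rightarrow> bool" where
  "\<lbrakk>|X| <o \<kappa>; finitely_supported X; \<forall>A\<in>X. is_formula A\<rbrakk> \<Longrightarrow> is_formula (Conj X)"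
| "is_formula A \<Longrightarrow> is_formula (Neg A)"
| "is_formula (Pred \<phi>)"
| "is_formula A \<Longrightarrow> is_formula (Dia \<alpha> A)"

inductive weak_formula :: "('k, 'pred, 'act) formula \<Rightarrow> bool" where
  "\<lbrakk>|X| <o \<kappa>; finitely_supported X; \<forall>A\<in>X. weak_formula A\<rbrakk> \<Longrightarrow> weak_formula (Conj X)"
| "weak_formula A \<Longrightarrow> weak_formula (Neg A)"
| "weak_formula A \<Longrightarrow> weak_formula (weak_Dia \<alpha> A)"
| "weak_formula A \<Longrightarrow> weak_formula (weak_Dia tau (Conj {A, Pred \<phi>}))"

lemma small_conjuncts: "|X| <o \<kappa> \<Longrightarrow> |X| \<le>o |UNIV :: (nat + 'k) set|"
proof -
  assume "|X| <o \<kappa>"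
  then have "|X| \<le>o |Field \<kappa>|" using kappa_card 
    by (meson card_of_Field_ordIso ordIso_symmetric ordLeq_ordIso_trans ordLess_imp_ordLeq)
  also have "|Field \<kappa>| \<le>o |UNIV :: 'k set|" by (simp add: card_of_mono1)
  also have "|UNIV :: 'k set| \<le>o |UNIV :: (nat + 'k) set|"
    by (rule card_of_ordLeqI[of Inr]) (auto)
  finally show ?thesis .
qed

lemma countable_less_kappa: "countable X \<Longrightarrow> |X| <o \<kappa>"
proof -
  assume "countable X"
  then have "|X| \<le>o |UNIV::nat set|" unfolding countable_def card_of_ordLeq[symmetric] by auto
  then show ?thesis using kappa_nat by (meson card_of_nat ordLeq_ordIso_trans ordLeq_ordLess_trans)
qed

lemma is_formula_finitely_supported: "is_formula A \<Longrightarrow> finitely_supported A"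
proof (induction rule: is_formula.induct)
  case (1 X)
  then show ?case unfolding finitely_supported_def supports_def by (metis Conj_eqvt small_conjuncts)
next
  case (2 A)
  then show ?case unfolding finitely_supported_def supports_def by (metis permute_Neg)
next
  case (3 \<phi>)
  then show ?case using nominal[of \<phi>] unfolding finitely_supported_def supports_def by (metis permute_Pred)
next
  case (4 A \<alpha>)
  obtain S T where "finite S" "S supports A" "finite T" "T supports \<alpha>"
    using 4(2) nominal[of \<alpha>] unfolding finitely_supported_def by blast
  then show ?case unfolding finitely_supported_def supports_def 
    by (intro exI[of _ "S \<union> T"]) (auto simp: Dia_eqvt fixes_names_def)
qed

lemma is_formula_weak_Dia_tau: "is_formula A \<Longrightarrow> is_formula (weak_Dia_tau A)"
  unfolding weak_Dia_tau_def Disj_def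
proof (rule is_formula.intros, rule is_formula.intros)
  let ?X = "Neg ` range (\<lambda>i. (Dia tau ^^ i) A)"
  assume A: "is_formula A"
  show "|?X| <o \<kappa>" by (rule countable_less_kappa) simp
  have "is_formula ((Dia tau ^^ i) A)" for i by (induction i) (auto intro: is_formula.intros A)
  then show "\<forall>A\<in>?X. is_formula A" by (auto intro: is_formula.intros)
  show "finitely_supported ?X" using is_formula_finitely_supported[OF A] unfolding finitely_supported_def supports_def
    by (simp add: permute_set_def image_image permute_Neg funpow_Dia_tau_eqvt) metis
qed

lemma weak_formula_is_formula: "weak_formula A \<Longrightarrow> is_formula A"
proof (induction rule: weak_formula.induct)
  case (4 A \<phi>)
  obtain S T where *: "finite S" "S supports A" "finite T" "T supports \<phi>"
    using is_formula_finitely_supported[OF 4(2)] nominal[of \<phi>] unfolding finitely_supported_def by blast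
  have "finitely_supported {A, Pred \<phi>}" using * unfolding finitely_supported_def supports_def 
    by (intro exI[of _ "S \<union> T"]) (auto simp: permute_Pred permute_set_def fixes_names_def)
  then have "is_formula (Conj {A, Pred \<phi>})" by (intro is_formula.intros) (auto intro: countable_less_kappa 4 is_formula.intros)
  then show ?case by (simp add: weak_Dia_def is_formula_weak_Dia_tau)
qed (auto simp: weak_Dia_def intro: is_formula.intros is_formula_weak_Dia_tau)

definition weakly_logically_equivalent :: "'state \<Rightarrow> 'state \<Rightarrow> bool" where
  "weakly_logically_equivalent P Q \<longleftrightarrow> (\<forall>A. weak_formula A \<longrightarrow> (P \<Turnstile> A \<longleftrightarrow> Q \<Turnstile> A))"

end

end

theory Submission
  imports Defs
begin

text \<open>Weak logical equivalence is itself a weak bisimulation. If no state of a set \<open>X\<close> is equivalent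
  to \<open>P\<close>, then a single weak formula holds of \<open>P\<close> and fails throughout \<open>X\<close>: a formula distinguishing
  \<open>P\<close> from one state may be replaced by the countable conjunction of its images under the permutations
  that fix \<open>supp P\<close>, and the conjunction of these over \<open>X\<close> is then supported by \<open>supp P\<close>. If a
  transition or a predicate of \<open>P\<close> had no match among the weak derivatives of \<open>Q\<close>, the weak modality
  applied to such a formula would hold of \<open>P\<close> but not of \<open>Q\<close>.

  The binding names of an action \<open>\<alpha>\<close> are fresh for \<open>Q\<close>, but perhaps not for the state that \<open>Q\<close> reaches
  by silent steps before it performs \<open>\<alpha>\<close>. A witness of the modality therefore performs an alpha-variant
  of \<open>\<alpha>\<close>; its binding names can be chosen fresh for \<open>Q\<close>, and then the renaming back to \<open>\<alpha>\<close> fixes \<open>Q\<close>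
  and can be applied to the whole weak transition.\<close>

section \<open>Permutations and supports\<close>

text \<open>This keeps the effect of a renaming on the names that matter, while every name outside
  \<open>S\<close> and its image stays fixed.\<close>

lemma ex_perm_restrict:
  assumes "finite S"
  shows "\<exists>q. (\<forall>a\<in>S. apply q a = apply p a) \<and> affected q \<subseteq> S \<union> apply p ` S"
  using assms
proof (induction S rule: finite_induct)
  case empty
  show ?case by (rule exI[of _ 1]) simp
next
  case (insert a S)
  then obtain q where q: "\<forall>c\<in>S. apply q c = apply p c" "affected q \<subseteq> S \<union> apply p ` S" by blast
  define q' where "q' = Perm.swap (apply q a) (apply p a) * q"
  have q': "apply q' c = (if apply q c = apply q a then apply p a
      else if apply q c = apply p a then apply q a else apply q c)" for c
    unfolding q'_def by (simp add: apply_times)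
  have "apply q' c = apply p c" if "c \<in> insert a S" for c
    using that q(1) insert.hyps(2) by (auto simp: q' apply_inj)
  moreover have "affected q' \<subseteq> insert a S \<union> apply p ` insert a S"
  proof
    fix c assume c: "c \<in> affected q'"
    show "c \<in> insert a S \<union> apply p ` insert a S"
    proof (rule ccontr)
      assume n: "c \<notin> insert a S \<union> apply p ` insert a S"
      then have "apply q c = c" using q(2) by (auto simp: in_affected)
      with n c show False by (auto simp: q' apply_inj in_affected split: if_splits)
    qed
  qed
  ultimately show ?case by blast
qed

lemma ex_perm_avoiding:
  fixes S F :: "name set"
  assumes "finite S" "finite F"
  shows "\<exists>p. apply p ` S \<inter> F = {} \<and> affected p \<subseteq> S \<union> apply p ` S"
proof -
  have "\<exists>p. apply p ` S \<inter> F = {}"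
    using assms(1)
  proof (induction S rule: finite_induct)
    case (insert a S)
    then obtain p where p: "apply p ` S \<inter> F = {}" by blast
    \<comment> \<open>The new image of \<open>a\<close> must also avoid the images already chosen,
      so that the swap leaves those in place.\<close>
    have "finite (F \<union> apply p ` S)" using assms(2) insert.hyps by simp
    then obtain b where b: "b \<notin> F \<union> apply p ` S" using infinite_name by (metis ex_new_if_finite)
    have "apply (Perm.swap (apply p a) b * p) c \<notin> F" if "c \<in> insert a S" for c
    proof (cases "c = a")
      case False
      then have "apply p c \<noteq> apply p a" by (simp add: apply_inj)
      moreover have "apply p c \<noteq> b" "apply p c \<notin> F" using that False p b by auto
      ultimately show ?thesis by (simp add: apply_times)
    qed (use b in \<open>simp add: apply_times\<close>)
    then show ?case by blast
  qed simp
  then obtain p where p: "apply p ` S \<inter> F = {}" by blast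
  obtain q where q: "\<forall>a\<in>S. apply q a = apply p a" "affected q \<subseteq> S \<union> apply p ` S"
    using ex_perm_restrict[OF assms(1)] by blast
  then have "apply q ` S = apply p ` S" by (simp cong: image_cong)
  with p q(2) show ?thesis by metis
qed

lemma fixes_names_iff_affected: "fixes_names p S \<longleftrightarrow> affected p \<inter> S = {}"
  by (auto simp: fixes_names_def in_affected)

lemma supports_permute_eqI:
  assumes "S supports x" "\<And>a. a \<in> S \<Longrightarrow> apply p a = apply q a"
  shows "p \<bullet> x = q \<bullet> x"
proof -
  have "fixes_names (inverse q * p) S"
    unfolding fixes_names_def
    using assms(2) by (simp add: apply_times)
      (metis apply_sequence apply_one perm.left_inverse comp_apply id_apply)
  then have "(inverse q * p) \<bullet> x = x" using assms(1) by (simp add: supports_def)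
  then show ?thesis by (metis permute_times permute_inverse(2))
qed

lemma finitely_supported_Pair:
  assumes "finitely_supported x" "finitely_supported y"
  shows "finitely_supported (x, y)"
proof -
  obtain S T where "finite S" "S supports x" "finite T" "T supports y"
    using assms unfolding finitely_supported_def by blast
  then show ?thesis unfolding finitely_supported_def supports_def
    by (intro exI[of _ "S \<union> T"]) (auto simp: permute_prod_def fixes_names_def)
qed

lemma finitely_supported_permute: "finitely_supported x \<Longrightarrow> finitely_supported (p \<bullet> x)"
  unfolding finitely_supported_def using supports_permute finite_permute_iff by metis

lemma fresh_set_eqvt: "S \<sharp> x \<Longrightarrow> (p \<bullet> S) \<sharp> (p \<bullet> x)"
  by (auto simp: fresh_set_def supp_eqvt permute_set_def permute_inject)

lemma alpha_class_refl: "(\<alpha>, x) \<in> alpha_class bn \<alpha> x"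
  unfolding alpha_class_def by (auto simp: fixes_names_def permute_one intro!: exI[of _ 1])

section \<open>Equivariance\<close>

context nominal_transition_system
begin

lemma weak_tau_eqvt: "weak_tau P P' \<Longrightarrow> weak_tau (p \<bullet> P) (p \<bullet> P')"
proof (induction rule: weak_tau.induct)
  case (2 P P'' P')
  then show ?case using trans_eqvt[OF 2(1), of p] by (auto simp: tau_eqvt intro: weak_tau.intros)
qed (rule weak_tau.intros)

lemma eq_tau_eqvt: "p \<bullet> \<alpha> = tau \<longleftrightarrow> \<alpha> = tau"
  by (metis permute_inject tau_eqvt)

lemma bn_tau: "bn tau = {}"
  using bn_supp[of tau] tau_supp by simp

text \<open>Equivariance is proved on representatives, where structural induction is available, and
  then lifted to the quotient.\<close>

lemma raw_sat_permute: "raw_sat t P \<longleftrightarrow> raw_sat (permute_raw p t) (p \<bullet> P)"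
proof (induction t arbitrary: P)
  case (RConj f)
  have "raw_sat s P \<longleftrightarrow> raw_sat (permute_raw p s) (p \<bullet> P)" if "s \<in> ran f" for s
    using that RConj by (auto simp: ran_def) (metis option.set_intros rangeI)+
  then show ?case by (simp add: ran_map_option)
next
  case (RPred \<phi>)
  show ?case using entails_eqvt[of P \<phi> p] entails_eqvt[of "p \<bullet> P" "p \<bullet> \<phi>" "inverse p"]
    by (auto simp: permute_inverse)
next
  case (RAlts f)
  have IH: "raw_sat (snd (f n)) P' \<longleftrightarrow> raw_sat (permute_raw p (snd (f n))) (p \<bullet> P')" for n P'
    using RAlts[of "f n" "snd (f n)"] by (simp add: snds.simps)
  have fr: "bn (p \<bullet> \<alpha>) \<sharp> p \<bullet> P \<longleftrightarrow> bn \<alpha> \<sharp> P" for \<alpha>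
    using fresh_set_eqvt[of "bn \<alpha>" P p] fresh_set_eqvt[of "p \<bullet> bn \<alpha>" "p \<bullet> P" "inverse p"]
    by (auto simp: bn_eqvt permute_inverse)
  have tr: "trans (p \<bullet> P) (p \<bullet> \<alpha>) P' \<longleftrightarrow> trans P \<alpha> (inverse p \<bullet> P')" for \<alpha> P'
    using trans_eqvt[of P \<alpha> "inverse p \<bullet> P'" p] trans_eqvt[of "p \<bullet> P" "p \<bullet> \<alpha>" P' "inverse p"]
    by (auto simp: permute_inverse)
  \<comment> \<open>Applying \<open>p\<close> is a bijection from the \<alpha>-successors of
    \<open>P\<close> to the \<open>p \<bullet> \<alpha>\<close>-successors of
    \<open>p \<bullet> P\<close>.\<close>
  have "(\<exists>P'. trans P \<alpha> P' \<and> raw_sat (snd (f n)) P') \<longleftrightarrow>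
    (\<exists>P'. trans (p \<bullet> P) (p \<bullet> \<alpha>) P' \<and> raw_sat (permute_raw p (snd (f n))) P')" for \<alpha> n
    unfolding IH tr by (metis permute_inverse)
  then show ?case by (simp add: case_prod_beta fr)
qed auto

lemma sat_permute: "P \<Turnstile> A \<Longrightarrow> p \<bullet> P \<Turnstile> p \<bullet> A"
  by transfer (simp flip: raw_sat_permute)

end

context nominal_transition_system_logic
begin

lemma weak_Dia_tau_eqvt:
  fixes A :: "('k, 'pred, 'act) formula"
  shows "p \<bullet> weak_Dia_tau A = weak_Dia_tau (p \<bullet> A)"
proof -
  let ?X = "Neg ` range (\<lambda>i. (Dia tau ^^ i) A)"
  have "p \<bullet> ?X = Neg ` range (\<lambda>i. (Dia tau ^^ i) (p \<bullet> A))"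
    by (simp add: permute_set_def image_image permute_Neg funpow_Dia_tau_eqvt)
  moreover have "|?X| \<le>o |UNIV :: (nat + 'k) set|"
    by (rule small_conjuncts[OF countable_less_kappa]) simp
  ultimately show ?thesis
    unfolding weak_Dia_tau_def Disj_def by (simp add: permute_Neg Conj_eqvt)
qed

lemma weak_Dia_eqvt:
  fixes A :: "('k, 'pred, 'act) formula"
  shows "p \<bullet> weak_Dia \<alpha> A = weak_Dia (p \<bullet> \<alpha>) (p \<bullet> A)"
  by (simp add: weak_Dia_def weak_Dia_tau_eqvt Dia_eqvt eq_tau_eqvt)

lemma card_permute_less_kappa: "|X| <o \<kappa> \<Longrightarrow> |p \<bullet> X| <o \<kappa>"
  unfolding permute_set_def using card_of_image ordLeq_ordLess_trans by blast

text \<open>Needed so that the permuted copies of a distinguishing formula may serve as conjuncts of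
  a weak formula.\<close>

lemma weak_formula_eqvt: "weak_formula A \<Longrightarrow> weak_formula (p \<bullet> A)"
proof (induction rule: weak_formula.induct)
  case (1 X)
  have "weak_formula (Conj (p \<bullet> X))"
  proof (rule weak_formula.intros)
    show "\<forall>A\<in>p \<bullet> X. weak_formula A" using 1(3) by (auto simp: permute_set_def)
  qed (use 1 card_permute_less_kappa finitely_supported_permute in blast)+
  then show ?case using Conj_eqvt[OF small_conjuncts[OF 1(1)]] by simp
next
  case (4 A \<phi>)
  have "p \<bullet> Conj {A, Pred \<phi>} = Conj {p \<bullet> A, Pred (p \<bullet> \<phi>)}"
    using Conj_eqvt[OF small_conjuncts[OF countable_less_kappa], of "{A, Pred \<phi>}" p]
    by (simp add: permute_set_def permute_Pred)
  then show ?case using 4 by (simp add: weak_Dia_eqvt tau_eqvt weak_formula.intros)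
qed (auto simp: permute_Neg weak_Dia_eqvt intro: weak_formula.intros)

section \<open>Satisfaction of the weak modalities\<close>

lemma is_formula_pair_supp:
  assumes "is_formula A"
  shows "finite (supp (\<alpha> :: 'act, A))" "supp (\<alpha>, A) supports (\<alpha>, A)"
  using supp_supports[OF finitely_supported_Pair[OF nominal is_formula_finitely_supported[OF assms]]]
  by auto

lemma sat_Dia_tau:
  assumes "is_formula A"
  shows "P \<Turnstile> Dia tau A \<longleftrightarrow> (\<exists>P'. trans P tau P' \<and> P' \<Turnstile> A)"
proof -
  have "alpha_class bn tau A \<subseteq> {(tau, A)}"
    using is_formula_pair_supp(2)[OF assms, of tau]
    by (auto simp: alpha_class_def bn_tau supports_def)
  then have "alpha_class bn tau A = {(tau, A)}" using alpha_class_refl by fastforce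
  then show ?thesis by (simp add: sat_Dia bn_tau fresh_set_def)
qed

text \<open>Disjunct \<open>i\<close> says that \<open>A\<close> can hold after exactly
  \<open>i\<close> silent steps.\<close>

lemma sat_weak_Dia_tau:
  assumes A: "is_formula A"
  shows "P \<Turnstile> weak_Dia_tau A \<longleftrightarrow> (\<exists>P'. weak_tau P P' \<and> P' \<Turnstile> A)"
proof -
  have f: "is_formula ((Dia tau ^^ i) A)" for i
    by (induction i) (auto intro: is_formula.intros A)
  have "|Neg ` range (\<lambda>i. (Dia tau ^^ i) A)| \<le>o |UNIV :: (nat + 'k) set|"
    by (rule small_conjuncts[OF countable_less_kappa]) simp
  then have *: "P \<Turnstile> weak_Dia_tau A \<longleftrightarrow> (\<exists>i. P \<Turnstile> (Dia tau ^^ i) A)"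
    unfolding weak_Dia_tau_def Disj_def by (simp add: sat_Neg sat_Conj)
  have "\<exists>P'. weak_tau P P' \<and> P' \<Turnstile> A" if "P \<Turnstile> (Dia tau ^^ i) A" for i
    using that
  proof (induction i arbitrary: P)
    case 0
    then show ?case by (auto intro: weak_tau.intros)
  next
    case (Suc i)
    then show ?case by (auto simp: sat_Dia_tau[OF f] intro: weak_tau.intros)
  qed
  moreover have "\<exists>i. P \<Turnstile> (Dia tau ^^ i) A" if "weak_tau P P'" "P' \<Turnstile> A" for P'
    using that
  proof (induction rule: weak_tau.induct)
    case (1 P)
    then show ?case by (intro exI[of _ 0]) simp
  next
    case (2 P P'' P')
    then obtain i where "P'' \<Turnstile> (Dia tau ^^ i) A" by blast
    with 2(1) show ?case by (intro exI[of _ "Suc i"]) (auto simp: sat_Dia_tau[OF f])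
  qed
  ultimately show ?thesis unfolding * by blast
qed

text \<open>In \<open>weak_simulation\<close> the binding names are fresh only for the simulating state, so the transition
  of \<open>P\<close> may have to be renamed before it witnesses the modality.\<close>

lemma sat_Dia_intro:
  assumes A: "is_formula A" and tr: "trans P \<alpha> P'" and sat: "P' \<Turnstile> A"
  shows "P \<Turnstile> Dia \<alpha> A"
proof -
  \<comment> \<open>A single permutation has to yield alpha-variants of both the transition and the
    formula, with binding names fresh for \<open>P\<close>.\<close>
  let ?F = "supp P \<union> supp (\<alpha>, P') \<union> supp (\<alpha>, A)"
  have "finite ?F"
    using supp_supports(1)[OF nominal, of P] is_formula_pair_supp(1)[OF A]
      supp_supports(1)[OF finitely_supported_Pair[OF nominal nominal], of \<alpha> P'] by blast
  then obtain p where p: "apply p ` bn \<alpha> \<inter> ?F = {}" "affected p \<subseteq> bn \<alpha> \<union> apply p ` bn \<alpha>"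
    using ex_perm_avoiding[OF bn_finite] by metis
  then have "fixes_names p (?F - bn \<alpha>)" unfolding fixes_names_iff_affected by blast
  then have "(p \<bullet> \<alpha>, p \<bullet> P') \<in> alpha_class bn \<alpha> P'" "(p \<bullet> \<alpha>, p \<bullet> A) \<in> alpha_class bn \<alpha> A"
    unfolding alpha_class_def fixes_names_def by (auto simp: permute_prod_def)
  moreover from this have "trans P (p \<bullet> \<alpha>) (p \<bullet> P')" using trans_alpha[OF tr] by blast
  moreover have "bn (p \<bullet> \<alpha>) \<sharp> P"
    using p(1) by (auto simp: bn_eqvt fresh_set_def permute_set_def permute_name_def)
  ultimately show ?thesis using sat_permute[OF sat, of p] unfolding sat_Dia by blast
qed

text \<open>The renaming behind a witness is constrained only on the free names of
  \<open>(\<alpha>, A)\<close> and may move names in \<open>F\<close>. It is traded for one with the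
  same effect on \<open>(\<alpha>, A)\<close> that fixes \<open>F\<close>; later \<open>F\<close> is
  the support of the simulating state.\<close>

lemma sat_Dia_elim:
  assumes A: "is_formula A" and sat: "P \<Turnstile> Dia \<alpha> A" and F: "finite F" "F \<inter> bn \<alpha> = {}"
  obtains q P' where "fixes_names q F" "trans P (q \<bullet> \<alpha>) P'" "P' \<Turnstile> q \<bullet> A"
proof -
  let ?S = "supp (\<alpha>, A)"
  obtain r P' where r: "fixes_names r (?S - bn \<alpha>)"
    and tr: "trans P (r \<bullet> \<alpha>) P'" and sat': "P' \<Turnstile> r \<bullet> A"
    using sat unfolding sat_Dia alpha_class_def by (auto simp: permute_prod_def)
  have bn: "bn (r \<bullet> \<alpha>) = apply r ` bn \<alpha>"
    by (simp add: bn_eqvt permute_set_def permute_name_def)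
  let ?T = "supp (r \<bullet> \<alpha>, P')"
  have "finite (F \<union> ?S \<union> ?T)"
    using F(1) is_formula_pair_supp(1)[OF A]
      supp_supports(1)[OF finitely_supported_Pair[OF nominal nominal]] by blast
  \<comment> \<open>A second renaming moves the witness's binding names away from \<open>F\<close>;
    avoiding \<open>?T\<close> makes it an alpha-conversion of the transition.\<close>
  then obtain p where p: "apply p ` bn (r \<bullet> \<alpha>) \<inter> (F \<union> ?S \<union> ?T) = {}"
    "affected p \<subseteq> bn (r \<bullet> \<alpha>) \<union> apply p ` bn (r \<bullet> \<alpha>)"
    using ex_perm_avoiding[OF bn_finite] by metis
  have "fixes_names p (?T - bn (r \<bullet> \<alpha>))" using p unfolding fixes_names_iff_affected by blast
  then have "(p \<bullet> r \<bullet> \<alpha>, p \<bullet> P') \<in> alpha_class bn (r \<bullet> \<alpha>) P'"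
    unfolding alpha_class_def by (auto simp: permute_prod_def)
  then have tr': "trans P (p \<bullet> r \<bullet> \<alpha>) (p \<bullet> P')" using trans_alpha[OF tr] by blast
  let ?s = "p * r"
  have s_bn: "apply ?s ` bn \<alpha> = apply p ` bn (r \<bullet> \<alpha>)" by (simp add: bn apply_times image_image)
  have s_fix: "apply ?s a = a" if "a \<in> ?S - bn \<alpha>" for a
  proof -
    have ra: "apply r a = a" using r that by (auto simp: fixes_names_def)
    then have "a \<notin> bn (r \<bullet> \<alpha>)" using that unfolding bn by (metis DiffD2 apply_inj imageE)
    then have "a \<notin> affected p" using p that by blast
    then have "apply p a = a" by (simp add: in_affected)
    with ra show ?thesis by (simp add: apply_times)
  qed
  \<comment> \<open>Off \<open>?S\<close>, the composite \<open>?s\<close> may still move names of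
    \<open>F\<close>. Its restriction \<open>q\<close> to \<open>bn \<alpha>\<close> agrees with it
    on \<open>?S\<close>, since both fix the free names there.\<close>
  obtain q where q: "\<forall>a\<in>bn \<alpha>. apply q a = apply ?s a" "affected q \<subseteq> bn \<alpha> \<union> apply ?s ` bn \<alpha>"
    using ex_perm_restrict[OF bn_finite] by blast
  have "apply q a = apply ?s a" if "a \<in> ?S" for a
  proof (cases "a \<in> bn \<alpha>")
    case False
    then have "a \<notin> affected q" using that q(2) p(1) unfolding s_bn by blast
    then have "apply q a = a" by (simp add: in_affected)
    then show ?thesis using s_fix that False by simp
  qed (use q in simp)
  then have "q \<bullet> (\<alpha>, A) = ?s \<bullet> (\<alpha>, A)"
    using supports_permute_eqI[OF is_formula_pair_supp(2)[OF A]] by blast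
  then have "q \<bullet> \<alpha> = p \<bullet> r \<bullet> \<alpha>" "q \<bullet> A = p \<bullet> r \<bullet> A" by (auto simp: permute_prod_def permute_times)
  moreover have "fixes_names q F"
    using q(2) p(1) F(2) unfolding s_bn fixes_names_iff_affected by blast
  ultimately show ?thesis using that[of q "p \<bullet> P'"] tr' sat_permute[OF sat', of p] by simp
qed

lemma sat_weak_Dia_intro:
  assumes A: "is_formula A" and "trans P \<alpha> P'" "P' \<Turnstile> A"
  shows "P \<Turnstile> weak_Dia \<alpha> A"
proof (cases "\<alpha> = tau")
  case True
  then show ?thesis using assms by (auto simp: weak_Dia_def sat_weak_Dia_tau intro: weak_tau.intros)
next
  case False
  have "P' \<Turnstile> weak_Dia_tau A" using assms by (auto simp: sat_weak_Dia_tau intro: weak_tau.intros)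
  then have "P \<Turnstile> Dia \<alpha> (weak_Dia_tau A)"
    using sat_Dia_intro is_formula_weak_Dia_tau assms by blast
  then show ?thesis using False
    by (auto simp: weak_Dia_def sat_weak_Dia_tau is_formula.intros is_formula_weak_Dia_tau A
        intro: weak_tau.intros)
qed

lemma sat_weak_Dia_elim:
  assumes A: "is_formula A" and sat: "Q \<Turnstile> weak_Dia \<alpha> A" and fr: "bn \<alpha> \<sharp> Q"
  obtains Q' where "weak_hat_trans Q \<alpha> Q'" "Q' \<Turnstile> A"
proof (cases "\<alpha> = tau")
  case True
  then show ?thesis using sat that by (auto simp: weak_Dia_def weak_hat_trans_def sat_weak_Dia_tau A)
next
  case False
  let ?B = "weak_Dia_tau A"
  have B: "is_formula ?B" by (rule is_formula_weak_Dia_tau[OF A])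
  obtain Q1 where Q1: "weak_tau Q Q1" "Q1 \<Turnstile> Dia \<alpha> ?B"
    using sat False by (auto simp: weak_Dia_def sat_weak_Dia_tau is_formula.intros B)
  have "supp Q \<inter> bn \<alpha> = {}" using fr by (auto simp: fresh_set_def)
  then obtain q Q2 where q: "fixes_names q (supp Q)" "trans Q1 (q \<bullet> \<alpha>) Q2" "Q2 \<Turnstile> q \<bullet> ?B"
    using sat_Dia_elim[OF B Q1(2) supp_supports(1)[OF nominal]] by metis
  \<comment> \<open>Undoing \<open>q\<close> along the whole run restores the label \<alpha> and
    leaves the starting state at \<open>Q\<close>.\<close>
  have "q \<bullet> Q = Q" using q(1) supp_supports(2)[OF nominal, of Q] by (simp add: supports_def)
  then have "inverse q \<bullet> Q = Q" by (metis permute_inverse(1))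
  then have "weak_tau Q (inverse q \<bullet> Q1)" using weak_tau_eqvt[OF Q1(1), of "inverse q"] by simp
  moreover have "trans (inverse q \<bullet> Q1) \<alpha> (inverse q \<bullet> Q2)"
    using trans_eqvt[OF q(2), of "inverse q"] by (simp add: permute_inverse)
  moreover have "inverse q \<bullet> Q2 \<Turnstile> ?B"
    using sat_permute[OF q(3), of "inverse q"] by (simp add: permute_inverse)
  then obtain Q' where "weak_tau (inverse q \<bullet> Q2) Q'" "Q' \<Turnstile> A" by (auto simp: sat_weak_Dia_tau A)
  ultimately show ?thesis using that False by (auto simp: weak_hat_trans_def weak_trans_def)
qed

section \<open>Distinguishing formulas\<close>

text \<open>The supporting set depends on \<open>P\<close> alone; this uniformity in
  \<open>Q\<close> is what permits conjunctions over many states.\<close>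

lemma ex_distinguishing_formula:
  assumes "\<not> weakly_logically_equivalent P Q"
  obtains B where "weak_formula B" "supp P supports B" "P \<Turnstile> B" "\<not> Q \<Turnstile> B"
proof -
  \<comment> \<open>If the distinguishing formula holds of \<open>Q\<close> instead of
    \<open>P\<close>, its negation is taken.\<close>
  obtain C where C: "weak_formula C" "P \<Turnstile> C" "\<not> Q \<Turnstile> C"
    using assms unfolding weakly_logically_equivalent_def
    by (metis sat_Neg weak_formula.intros(2))
  let ?X = "(\<lambda>p. p \<bullet> C) ` {p. fixes_names p (supp P)}"
  have "countable ?X" using countable_perm by (metis countable_image countable_subset subset_UNIV)
  then have X: "|?X| <o \<kappa>" by (rule countable_less_kappa)
  have "q \<bullet> ?X = ?X" if q: "fixes_names q (supp P)" for q
  proof -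
    have comp: "fixes_names (r * s) (supp P)"
      if "fixes_names r (supp P)" "fixes_names s (supp P)" for r s
      using that by (auto simp: fixes_names_def apply_times)
    have "fixes_names (inverse q) (supp P)"
      using q unfolding fixes_names_def
      by (metis apply_one apply_sequence comp_apply id_apply perm.left_inverse)
    note comp[OF this]
    moreover have "p \<bullet> C = q \<bullet> (inverse q * p) \<bullet> C" for p
      by (simp add: permute_times permute_inverse)
    ultimately have "?X \<subseteq> q \<bullet> ?X" unfolding permute_set_def by blast
    moreover have "q \<bullet> ?X \<subseteq> ?X"
      using comp[OF q] unfolding permute_set_def by (auto simp flip: permute_times)
    ultimately show ?thesis by blast
  qed
  then have supp: "supp P supports ?X" by (simp add: supports_def)
  then have fs: "finitely_supported ?X"
    unfolding finitely_supported_def using supp_supports(1)[OF nominal] by blast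
  have "weak_formula (Conj ?X)"
    by (rule weak_formula.intros) (use X fs C(1) weak_formula_eqvt in auto)
  moreover have "supp P supports Conj ?X"
    using supp Conj_eqvt[OF small_conjuncts[OF X]] by (simp add: supports_def)
  \<comment> \<open>Such a \<open>p\<close> fixes \<open>P\<close> itself, so equivariance carries
    satisfaction of \<open>C\<close> to each copy.\<close>
  moreover have "P \<Turnstile> p \<bullet> C" if "fixes_names p (supp P)" for p
    using sat_permute[OF C(2), of p] supp_supports(2)[OF nominal, of P] that
    by (simp add: supports_def)
  then have "P \<Turnstile> Conj ?X" unfolding sat_Conj[OF small_conjuncts[OF X]] by blast
  moreover have "C \<in> ?X" by (rule image_eqI[of _ _ 1]) (auto simp: permute_one fixes_names_def)
  then have "\<not> Q \<Turnstile> Conj ?X" unfolding sat_Conj[OF small_conjuncts[OF X]] using C(3) by blast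
  ultimately show ?thesis using that by blast
qed

lemma ex_separating_formula:
  assumes "\<And>Q. Q \<in> S \<Longrightarrow> \<not> weakly_logically_equivalent P Q"
  obtains A where "weak_formula A" "P \<Turnstile> A" "\<And>Q. Q \<in> S \<Longrightarrow> \<not> Q \<Turnstile> A"
proof -
  have "\<forall>Q\<in>S. \<exists>B. weak_formula B \<and> supp P supports B \<and> P \<Turnstile> B \<and> \<not> Q \<Turnstile> B"
    using assms by (blast elim: ex_distinguishing_formula)
  then obtain B where B: "\<And>Q. Q \<in> S \<Longrightarrow>
      weak_formula (B Q) \<and> supp P supports B Q \<and> P \<Turnstile> B Q \<and> \<not> Q \<Turnstile> B Q"
    by metis
  have "|B ` S| \<le>o |UNIV :: 'state set|"
    using card_of_image card_of_mono1[of S UNIV] ordLeq_transitive by blast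
  then have X: "|B ` S| <o \<kappa>" using kappa_state ordLeq_ordLess_trans by blast
  \<comment> \<open>The choice \<open>B\<close> is arbitrary and \<open>S\<close> may lack finite
    support, but \<open>p\<close> fixes each conjunct individually.\<close>
  have "p \<bullet> B ` S = B ` S" if "fixes_names p (supp P)" for p
    using B that by (simp add: permute_set_def image_image supports_def cong: image_cong)
  then have "finitely_supported (B ` S)"
    unfolding finitely_supported_def supports_def using supp_supports(1)[OF nominal] by blast
  then have "weak_formula (Conj (B ` S))" using X B by (intro weak_formula.intros) auto
  then show ?thesis
    by (rule that) (use B in \<open>auto simp: sat_Conj[OF small_conjuncts[OF X]]\<close>)
qed

section \<open>Weak logical equivalence is a weak bisimulation\<close>

lemma sat_Conj_Pred:
  fixes A :: "('k, 'pred, 'act) formula"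
  shows "P \<Turnstile> Conj {A, Pred \<phi>} \<longleftrightarrow> P \<Turnstile> A \<and> P \<turnstile> \<phi>"
  using sat_Conj[OF small_conjuncts[OF countable_less_kappa], of "{A, Pred \<phi>}" P]
  by (simp add: sat_Pred)

lemma is_formula_Conj_Pred:
  assumes "is_formula A"
  shows "is_formula (Conj {A, Pred \<phi>})"
proof (rule is_formula.intros)
  show "|{A, Pred \<phi>}| <o \<kappa>" by (rule countable_less_kappa) simp
  show "\<forall>B\<in>{A, Pred \<phi>}. is_formula B" using assms by (auto intro: is_formula.intros)
  obtain S T where "finite S" "S supports A" "finite T" "T supports \<phi>"
    using is_formula_finitely_supported[OF assms] nominal[of \<phi>]
    unfolding finitely_supported_def by blast
  then show "finitely_supported {A, Pred \<phi>}" unfolding finitely_supported_def supports_def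
    by (intro exI[of _ "S \<union> T"]) (auto simp: permute_Pred permute_set_def fixes_names_def)
qed

lemma weak_simulation_weakly_logically_equivalent: "weak_simulation weakly_logically_equivalent"
  unfolding weak_simulation_def
proof (intro allI impI, rule ccontr)
  fix P Q \<alpha> P'
  assume eq: "weakly_logically_equivalent P Q" and fr: "bn \<alpha> \<sharp> Q" and tr: "trans P \<alpha> P'"
    and n: "\<nexists>Q'. weak_hat_trans Q \<alpha> Q' \<and> weakly_logically_equivalent P' Q'"
  obtain A where A: "weak_formula A" "P' \<Turnstile> A" "\<And>Q'. weak_hat_trans Q \<alpha> Q' \<Longrightarrow> \<not> Q' \<Turnstile> A"
    using ex_separating_formula[of "{Q'. weak_hat_trans Q \<alpha> Q'}" P'] n by auto
  note f = weak_formula_is_formula[OF A(1)]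
  have "P \<Turnstile> weak_Dia \<alpha> A" by (rule sat_weak_Dia_intro[OF f tr A(2)])
  then have "Q \<Turnstile> weak_Dia \<alpha> A"
    using eq A(1) unfolding weakly_logically_equivalent_def by (blast intro: weak_formula.intros)
  then show False using sat_weak_Dia_elim[OF f _ fr] A(3) by blast
qed

lemma weak_static_implication_weakly_logically_equivalent:
  "weak_static_implication weakly_logically_equivalent"
  unfolding weak_static_implication_def
proof (intro allI impI, rule ccontr)
  fix P Q \<phi>
  assume eq: "weakly_logically_equivalent P Q" and P: "P \<turnstile> \<phi>"
    and n: "\<nexists>Q'. weak_tau Q Q' \<and> Q' \<turnstile> \<phi> \<and> weakly_logically_equivalent P Q'"
  obtain A where A: "weak_formula A" "P \<Turnstile> A"
    "\<And>Q'. weak_tau Q Q' \<Longrightarrow> Q' \<turnstile> \<phi> \<Longrightarrow> \<not> Q' \<Turnstile> A"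
    by (rule ex_separating_formula[of "{Q'. weak_tau Q Q' \<and> Q' \<turnstile> \<phi>}" P]) (use n in auto)
  \<comment> \<open>Placing both conjuncts under one modality forces a single silent derivative to
    satisfy \<phi> and \<open>A\<close> together. \<open>P\<close> satisfies the result by the empty
    run.\<close>
  let ?B = "Conj {A, Pred \<phi>}"
  have sat: "R \<Turnstile> weak_Dia tau ?B \<longleftrightarrow> (\<exists>R'. weak_tau R R' \<and> R' \<Turnstile> A \<and> R' \<turnstile> \<phi>)" for R
    using sat_weak_Dia_tau[OF is_formula_Conj_Pred[OF weak_formula_is_formula[OF A(1)]]]
    by (simp add: weak_Dia_def sat_Conj_Pred)
  have "P \<Turnstile> weak_Dia tau ?B" unfolding sat using A(2) P by (blast intro: weak_tau.intros)
  then have "Q \<Turnstile> weak_Dia tau ?B"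
    using eq A(1) unfolding weakly_logically_equivalent_def by (blast intro: weak_formula.intros)
  then show False using A(3) unfolding sat by blast
qed

lemma weak_bisimulation_weakly_logically_equivalent:
  "weak_bisimulation weakly_logically_equivalent"
  unfolding weak_bisimulation_def
  using weak_simulation_weakly_logically_equivalent
    weak_static_implication_weakly_logically_equivalent
  by (auto simp: symp_def weakly_logically_equivalent_def)

end

theorem theorem7p17:
  fixes entails :: "'state::nominal \<Rightarrow> 'pred::nominal \<Rightarrow> bool"
    and bn :: "'act::nominal \<Rightarrow> name set"
    and trans :: "'state \<Rightarrow> 'act \<Rightarrow> 'state \<Rightarrow> bool"
    and tau :: 'act
    and \<kappa> :: "'k rel"
    and P Q :: 'state
  assumes "nominal_transition_system_logic entails bn trans tau \<kappa>"
    and "nominal_transition_system_logic.weakly_logically_equivalent entails bn trans tau \<kappa> P Q"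
  shows "nominal_transition_system.weakly_bisimilar entails bn trans tau P Q"
proof -
  interpret nominal_transition_system_logic entails bn trans tau \<kappa> by (rule assms(1))
  show ?thesis
    using weak_bisimulation_weakly_logically_equivalent assms(2)
    unfolding weakly_bisimilar_def by blast
qed

end
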